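(* Let $k$ be a positive integer, write $[k]=\{1,\dots,k\}$, and for each natural number $n$ (including $n=0$) let $g_1(n), g_2(n), \dots, g_k(n)$ be impartial games. For every $i\in[k]$ let $S_i$ be a subset of $[k]\times[k]$. Suppose that for all $n$ and all $i\in[k]$, every playable move on $g_i(n)$ is denoted by a quadruple $(p,q,a,b)$ and splits the game into $g_p(a)$ and $g_q(b)$ (that is, it results in the disjunctive sum $g_p(a)+g_q(b)$), where $(p,q)\in S_i$, $a$ and $b$ are non-negative integers, and $a+b+1=n$. Let $s\ge T$ be positive integers. Suppose further that for every $i\in[k]$ and every $(p,q)\in S_i$: 1. For all integers $a,b\ge s-T$ with $a,b\geq 0$, the move $(p,q,a,b)$ is valid on $g_i(n)$ for $n=a+b+1$. 2. For every integer $a$ with $0\le a<s-T$: if there is some $n$ with $n-a-1\ge s-T$ such that the move $(p,q,a,n-a-1)$ is invalid on $g_i(n)$, then the move $(p,q,a,m-a-1)$ is invalid on $g_i(m)$ for all natural numbers $m$. 3. For every integer $b$ with $0\le b<s-T$: if there is some $n$ with $n-b-1\ge s-T$ such that the move $(p,q,n-b-1,b)$ is invalid on $g_i(n)$, then the move $(p,q,m-b-1,b)$ is invalid on $g_i(m)$ for all natural numbers $m$. Finally, suppose that for all integers $n\in[s+1,2s+1]$ and all $i\in[k]$, $\mathrm{Nim}(g_i(n))=\mathrm{Nim}(g_i(n-T))$. Then $\mathrm{Nim}(g_i(n))=\mathrm{Nim}(g_i(n-T))$ for all integers $n\ge s+1$ and all $i\in[k]$.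
   Context: Games are finite impartial games under normal play (two players alternate; a player unable to move loses). $\mathrm{Nim}(G)$ denotes the Nimber (Sprague–Grundy value) of $G$: the mex (minimum excluded non-negative integer) of the set of Nimbers of all positions reachable from $G$ in one move; a game with no moves has Nimber $0$. The Nimber of a disjunctive sum of two games is the bitwise xor of their Nimbers. For $(p,q)\in S_i$ and non-negative integers $a,b$ with $a+b+1=n$, the quadruple $(p,q,a,b)$ is called valid (or playable) on $g_i(n)$ if there is a legal move in $g_i(n)$ whose result is $g_p(a)+g_q(b)$ denoted by this quadruple, and invalid otherwise. Every legal move of $g_i(n)$ is given by such a quadruple. *)

theory Defs
  imports Main "HOL-Library.FSet"
begin

text \<open>
  A finite impartial game under normal play is identified with the finite set of the
  positions reachable from it in one move, as in Conway's treatment. Being a datatype,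
  every play terminates.
\<close>

datatype game = Game (options: "game fset")

definition mex :: "nat set \<Rightarrow> nat" where
  "mex A = (LEAST n. n \<notin> A)"

primrec nim :: "game \<Rightarrow> nat" where
  "nim (Game X) = mex (fset (nim |`| X))"

lemma size_option_less: "G' |\<in>| options G \<Longrightarrow> size G' < size G"
proof (cases G)
  case (Game X)
  moreover assume "G' |\<in>| options G"
  ultimately have "Suc (size G') \<le> (\<Sum>H\<in>fset X. Suc (size H))"
    by (intro member_le_sum) auto
  with Game show ?thesis by simp
qed

text \<open>Disjunctive sum: a move consists of a move in exactly one of the two components.\<close>

function game_sum :: "game \<Rightarrow> game \<Rightarrow> game" (infixl "\<oplus>" 65) where
  "G \<oplus> H = Game ((\<lambda>G'. G' \<oplus> H) |`| options G |\<union>| (\<lambda>H'. G \<oplus> H') |`| options H)"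
  by auto
termination
  by (relation "measure (\<lambda>(G, H). size G + size H)") (auto dest: size_option_less)

declare game_sum.simps [simp del]

end

theory Submission
  imports Defs
begin

text \<open>
  Strong induction on \<open>n\<close>; for \<open>n \<ge> 2 * s + 2\<close> the options of \<open>g i n\<close> and \<open>g i (n - T)\<close>
  have the same nimbers. Indeed, in a move \<open>(p, q, a, b)\<close> on either game the larger of \<open>a\<close>
  and \<open>b\<close> is at least \<open>s + 1\<close>, respectively at least \<open>s + 1 - T\<close>. Shifting it by \<open>T\<close> does
  not change its nimber, by induction, nor the validity of the move, by the three conditions.
  Instead of the full xor rule, only the fact that the nimber of a sum is a function of
  the nimbers of the summands is needed.
\<close>

lemma mex_notin: "finite A \<Longrightarrow> mex A \<notin> A"
  unfolding mex_def by (rule LeastI_ex) (rule ex_new_if_finite, simp_all)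

lemma less_mex_in: "m < mex A \<Longrightarrow> m \<in> A"
  unfolding mex_def using not_less_Least by blast

lemma mex_eqI: "x \<notin> A \<Longrightarrow> (\<And>y. y < x \<Longrightarrow> y \<in> A) \<Longrightarrow> mex A = x"
  unfolding mex_def by (rule Least_equality) (auto simp: not_less[symmetric])

text \<open>Nim addition in Conway's recursive form. The recursion mirrors the options of a
  disjunctive sum, so binary digits never enter.\<close>

function nim_add :: "nat \<Rightarrow> nat \<Rightarrow> nat" where
  "nim_add m n = mex ((\<lambda>m'. nim_add m' n) ` {..<m} \<union> nim_add m ` {..<n})"
  by auto
termination
  by (relation "measure (\<lambda>(m, n). m + n)") auto

declare nim_add.simps [simp del]

lemma nim_add_less_neq:
  "m' < m \<Longrightarrow> nim_add m n \<noteq> nim_add m' n"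
  "n' < n \<Longrightarrow> nim_add m n \<noteq> nim_add m n'"
  using mex_notin[of "(\<lambda>m'. nim_add m' n) ` {..<m} \<union> nim_add m ` {..<n}"]
  by (auto simp: nim_add.simps[of m n])

text \<open>Of two distinct arguments one is smaller, and the value at the smaller one is among
  those excluded by the mex at the larger one.\<close>

lemma nim_add_cancel:
  "nim_add m n = nim_add m' n \<longleftrightarrow> m = m'"
  "nim_add m n = nim_add m n' \<longleftrightarrow> n = n'"
  by (metis nat_neq_iff nim_add_less_neq)+

lemma nim_eq_mex: "nim G = mex (nim ` fset (options G))"
  by (cases G) simp

lemma nim_option_neq: "G' |\<in>| options G \<Longrightarrow> nim G' \<noteq> nim G"
  using mex_notin[of "nim ` fset (options G)"] by (force simp: nim_eq_mex[of G])

lemma less_nim_option: "m < nim G \<Longrightarrow> \<exists>G'. G' |\<in>| options G \<and> nim G' = m"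
  using less_mex_in[of m "nim ` fset (options G)"] by (auto simp: nim_eq_mex[of G])

lemma options_game_sum:
  "fset (options (G \<oplus> H)) =
    (\<lambda>G'. G' \<oplus> H) ` fset (options G) \<union> (\<lambda>H'. G \<oplus> H') ` fset (options H)"
  by (subst game_sum.simps) simp

text \<open>The options of \<open>G\<close> realize every value below \<open>nim G\<close>, but
  possibly larger ones too, so \<open>?A\<close> can exceed the set in the recursion of
  \<open>nim_add\<close>. The surplus cannot change the mex: no option has the nimber of its game,
  and by cancellation this carries over to the sums.\<close>

lemma nim_game_sum: "nim (G \<oplus> H) = nim_add (nim G) (nim H)"
proof (induction G H rule: game_sum.induct)
  case (1 G H)
  let ?A = "(\<lambda>G'. nim_add (nim G') (nim H)) ` fset (options G) \<union>
    (\<lambda>H'. nim_add (nim G) (nim H')) ` fset (options H)"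
  have "nim ` fset (options (G \<oplus> H)) = ?A"
    unfolding options_game_sum image_Un image_image using 1 by simp
  moreover have "mex ?A = nim_add (nim G) (nim H)"
  proof (rule mex_eqI)
    show "nim_add (nim G) (nim H) \<notin> ?A"
      using nim_option_neq by (auto simp: nim_add_cancel) metis+
  next
    \<comment> \<open>A smaller value arises in the recursion by lowering one summand; some option
      of that component has the lowered nimber.\<close>
    fix y assume "y < nim_add (nim G) (nim H)"
    then have "y \<in> (\<lambda>m. nim_add m (nim H)) ` {..<nim G} \<union> nim_add (nim G) ` {..<nim H}"
      by (intro less_mex_in) (simp flip: nim_add.simps)
    then show "y \<in> ?A"
      using less_nim_option by fastforce
  qed
  ultimately show ?case
    by (simp add: nim_eq_mex[of "G \<oplus> H"])
qed

theorem theorem2: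
  fixes k s T :: nat
    and g :: "nat \<Rightarrow> nat \<Rightarrow> game"
    and S :: "nat \<Rightarrow> (nat \<times> nat) set"
    and valid :: "nat \<Rightarrow> nat \<Rightarrow> nat \<times> nat \<times> nat \<times> nat \<Rightarrow> bool"
  assumes k_pos: "0 < k"
    and S_subset: "\<forall>i\<in>{1..k}. S i \<subseteq> {1..k} \<times> {1..k}"
    and valid_move: "\<forall>i\<in>{1..k}. \<forall>n p q a b. valid i n (p, q, a, b) \<longrightarrow>
          (p, q) \<in> S i \<and> a + b + 1 = n \<and> g p a \<oplus> g q b |\<in>| options (g i n)"
    and move_valid: "\<forall>i\<in>{1..k}. \<forall>n G. G |\<in>| options (g i n) \<longrightarrow>
          (\<exists>p q a b. valid i n (p, q, a, b) \<and> G = g p a \<oplus> g q b)"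
    and T_pos: "0 < T"
    and T_le_s: "T \<le> s"
    and cond1: "\<forall>i\<in>{1..k}. \<forall>(p, q)\<in>S i. \<forall>a b. s - T \<le> a \<longrightarrow> s - T \<le> b \<longrightarrow>
          valid i (a + b + 1) (p, q, a, b)"
    and cond2: "\<forall>i\<in>{1..k}. \<forall>(p, q)\<in>S i. \<forall>a<s - T.
          (\<exists>n\<ge>a + 1. s - T \<le> n - a - 1 \<and> \<not> valid i n (p, q, a, n - a - 1)) \<longrightarrow>
          (\<forall>m\<ge>a + 1. \<not> valid i m (p, q, a, m - a - 1))"
    and cond3: "\<forall>i\<in>{1..k}. \<forall>(p, q)\<in>S i. \<forall>b<s - T.
          (\<exists>n\<ge>b + 1. s - T \<le> n - b - 1 \<and> \<not> valid i n (p, q, n - b - 1, b)) \<longrightarrow>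
          (\<forall>m\<ge>b + 1. \<not> valid i m (p, q, m - b - 1, b))"
    and base: "\<forall>n\<in>{s + 1..2 * s + 1}. \<forall>i\<in>{1..k}. nim (g i n) = nim (g i (n - T))"
  shows "\<forall>n\<ge>s + 1. \<forall>i\<in>{1..k}. nim (g i n) = nim (g i (n - T))"
proof (intro allI impI)
  fix n assume "s + 1 \<le> n"
  then show "\<forall>i\<in>{1..k}. nim (g i n) = nim (g i (n - T))"
  proof (induction n rule: less_induct)
    case (less n)
    have period: "nim (g p c) = nim (g p (c - T))" if "p \<in> {1..k}" "s + 1 \<le> c" "c < n" for p c
      using less.IH that by blast
    show ?case
    proof (cases "n \<le> 2 * s + 1")
      case True
      then show ?thesis using base less.prems by simp
    next
      case False
      show ?thesis
      proof
        fix i assume i: "i \<in> {1..k}"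
        have valid: "(p, q) \<in> S i" "a + b + 1 = m" "g p a \<oplus> g q b |\<in>| options (g i m)"
          if "valid i m (p, q, a, b)" for m p q a b
          using bspec[OF valid_move i, rule_format, OF that] by simp_all
        have index: "p \<in> {1..k}" "q \<in> {1..k}" "a + b + 1 = m"
          if "valid i m (p, q, a, b)" for m p q a b
          using valid[OF that] bspec[OF S_subset i] by auto
        \<comment> \<open>For fixed \<open>a\<close>, validity is constant over all right indices
          from \<open>s - T\<close> on. If \<open>a\<close> is large as well, \<open>cond1\<close>
          applies; otherwise, by \<open>cond2\<close>, a single invalid move in this range would
          make the given move invalid too.\<close>
        have right: "valid i m' (p, q, a, b')"
          if v: "valid i m (p, q, a, b)" and "s - T \<le> b" "s - T \<le> b'" "a + b' + 1 = m'"
          for m m' p q a b b'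
        proof (cases "s - T \<le> a")
          case True
          then show ?thesis using bspec[OF bspec[OF cond1 i] valid(1)[OF v]] that by auto
        next
          case False
          have pq: "(p, q) \<in> S i" and m: "m = a + b + 1" using valid[OF v] by simp_all
          show ?thesis
          proof (rule ccontr)
            assume "\<not> ?thesis"
            then have "\<exists>n\<ge>a + 1. s - T \<le> n - a - 1 \<and> \<not> valid i n (p, q, a, n - a - 1)"
              using that by (intro exI[of _ m']) auto
            then have "\<forall>m\<ge>a + 1. \<not> valid i m (p, q, a, m - a - 1)"
              using bspec[OF bspec[OF cond2 i] pq] False by simp
            from this[rule_format, of m] show False using v m by simp
          qed
        qed
        \<comment> \<open>The mirror image of \<open>right\<close>, with \<open>cond3\<close> in
          place of \<open>cond2\<close>.\<close>
        have left: "valid i m' (p, q, a', b)"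
          if v: "valid i m (p, q, a, b)" and "s - T \<le> a" "s - T \<le> a'" "a' + b + 1 = m'"
          for m m' p q a a' b
        proof (cases "s - T \<le> b")
          case True
          then show ?thesis using bspec[OF bspec[OF cond1 i] valid(1)[OF v]] that by auto
        next
          case False
          have pq: "(p, q) \<in> S i" and m: "m = a + b + 1" using valid[OF v] by simp_all
          show ?thesis
          proof (rule ccontr)
            assume "\<not> ?thesis"
            then have "\<exists>n\<ge>b + 1. s - T \<le> n - b - 1 \<and> \<not> valid i n (p, q, n - b - 1, b)"
              using that by (intro exI[of _ m']) auto
            then have "\<forall>m\<ge>b + 1. \<not> valid i m (p, q, m - b - 1, b)"
              using bspec[OF bspec[OF cond3 i] pq] False by simp
            from this[rule_format, of m] show False using v m by simp
          qed
        qed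
        \<comment> \<open>Collecting the nimbers by quadruples lets moves on \<open>g i n\<close>
          and \<open>g i (n - T)\<close> be matched although the resulting games differ.\<close>
        define N
          where "N m = {nim_add (nim (g p a)) (nim (g q b)) |p q a b. valid i m (p, q, a, b)}" for m
        have in_N: "nim_add (nim (g p a)) (nim (g q b)) \<in> N m"
          if "valid i m (p, q, a, b)" for m p q a b
          using that unfolding N_def by blast
        have nim_N: "nim (g i m) = mex (N m)" for m
        proof -
          have "nim ` fset (options (g i m)) = N m"
          proof
            show "nim ` fset (options (g i m)) \<subseteq> N m"
            proof
              fix x assume "x \<in> nim ` fset (options (g i m))"
              then obtain G where G: "G |\<in>| options (g i m)" "x = nim G" by blast
              with move_valid i obtain p q a b
                where "valid i m (p, q, a, b)" "G = g p a \<oplus> g q b" by meson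
              with G show "x \<in> N m" unfolding N_def by (auto simp: nim_game_sum)
            qed
            show "N m \<subseteq> nim ` fset (options (g i m))"
              using valid(3) unfolding N_def by (auto simp flip: nim_game_sum)
          qed
          then show ?thesis by (simp add: nim_eq_mex[of "g i m"])
        qed
        have "N n \<subseteq> N (n - T)"
        proof
          fix x assume "x \<in> N n"
          then obtain p q a b where v: "valid i n (p, q, a, b)"
            and x: "x = nim_add (nim (g p a)) (nim (g q b))"
            unfolding N_def by blast
          note ix = index[OF v]
          show "x \<in> N (n - T)"
          proof (cases "a \<le> b")
            case True
            \<comment> \<open>Here a + b = n - 1 \<ge> 2s + 1 and a \<le> b force b \<ge> s + 1.
              Hence b - T still lies in the range of \<open>right\<close>, and \<open>period\<close>
              applies at b < n. This is where the bound 2s + 1 of the base range comes from.\<close>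
            then have "valid i (n - T) (p, q, a, b - T)"
              using right[OF v] ix False T_pos T_le_s by simp
            moreover have "nim (g q b) = nim (g q (b - T))"
              using period ix True False by simp
            ultimately show ?thesis unfolding x using in_N by metis
          next
            case b_less: False
            then have "valid i (n - T) (p, q, a - T, b)"
              using left[OF v] ix False T_pos T_le_s by simp
            moreover have "nim (g p a) = nim (g p (a - T))"
              using period ix b_less False by simp
            ultimately show ?thesis unfolding x using in_N by metis
          qed
        qed
        moreover have "N (n - T) \<subseteq> N n"
        proof
          fix x assume "x \<in> N (n - T)"
          then obtain p q a b where v: "valid i (n - T) (p, q, a, b)"
            and x: "x = nim_add (nim (g p a)) (nim (g q b))"
            unfolding N_def by blast
          note ix = index[OF v]
          show "x \<in> N n"
          proof (cases "a \<le> b")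
            case True
            \<comment> \<open>Now 2b \<ge> a + b \<ge> 2s + 1 - T \<ge> 2(s + 1 - T), the last step
              because T \<ge> 1. So b + T \<ge> s + 1, and b + T = n - 1 - a < n, which allows
              \<open>period\<close> at b + T.\<close>
            then have "valid i n (p, q, a, b + T)"
              using right[OF v] ix False T_pos T_le_s by simp
            moreover have "nim (g q (b + T)) = nim (g q b)"
              using period[of q "b + T"] ix True False T_pos T_le_s by simp
            ultimately show ?thesis unfolding x using in_N by metis
          next
            case b_less: False
            then have "valid i n (p, q, a + T, b)"
              using left[OF v] ix False T_pos T_le_s by simp
            moreover have "nim (g p (a + T)) = nim (g p a)"
              using period[of p "a + T"] ix b_less False T_pos T_le_s by simp
            ultimately show ?thesis unfolding x using in_N by metis
          qed
        qed
        ultimately show "nim (g i n) = nim (g i (n - T))"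
          by (simp add: nim_N)
      qed
    qed
  qed
qed

end
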